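(* Let $g_1,\dots,g_n$ be positive integers, $G=\mathbb{Z}/g_1\mathbb{Z}\times\cdots\times\mathbb{Z}/g_n\mathbb{Z}$, let $L\le G$ be a lattice code (a subgroup of $G$) given by a parity check matrix $H$, and let $\prec$ be a total degree compatible admissible term ordering on the monomials in $x_1,\dots,x_n$. Then the algorithm described in the context, run on input $(\prec,n,H)$, computes the extended complete reduced Gröbner basis of $L$ with respect to $\prec$; that is, it terminates and the set $\mathcal{B}$ that it returns is equal to $$\mathrm{ECrGb}(L)=\{x^{\mathbf a}-x^{\mathbf b}\mid x^{\mathbf a}\in \mathrm{IT}(L),\ \mathbf b\in \mathrm{CL}(\mathbf a),\ \mathbf a\neq\mathbf b\}\subseteq \mathbb{F}_2[x_1,\dots,x_n].$$
   Context: **Notation.** $[X]$ is the set of monomials $x^{\mathbf a}=x_1^{a_1}\cdots x_n^{a_n}$, $\mathbf a\in\mathbb{Z}_{\ge 0}^n$. An element $\mathbf a\in G$ is identified with its vector of integer representatives $(a_1,\dots,a_n)$, $0\le a_i\le g_i-1$; correspondingly $x^{\mathbf a}$ for $\mathbf a\in G$ is the monomial with these exponents. For $\mathbf a\in\mathbb{Z}_{\ge0}^n$, writing "$\mathbf a\in \mathrm{CL}(L)$" means that $0\le a_i\le g_i-1$ for all $i$ and that the corresponding element of $G$ belongs to $\mathrm{CL}(L)$. The $G$-norm of $\mathbf a\in G$ is $\|\mathbf a\|_G=a_1+\dots+a_n$ (sum of the integer representatives). The support is $\mathrm{supp}(\mathbf a)=\{i\mid a_i\ne0\}$. A term ordering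 is total degree compatible if $\deg u<\deg v$ implies $u\prec v$. **Coset leaders.** $\mathrm{CL}(L)$ is the set of all $\mathbf a\in G$ such that $\|\mathbf a\|_G$ is minimal among all elements of the coset $\mathbf a+L$ (a coset may have several leaders). For $\mathbf a\in\mathbb{Z}_{\ge0}^n$, $\mathrm{CL}(\mathbf a)$ is the set of $\mathbf b\in\mathrm{CL}(L)$ lying in the same coset of $L$ as the class of $\mathbf a$ in $G$. **Irredundant terms.** $x^{\mathbf a}\in[X]$ belongs to $\mathrm{IT}(L)$ if and only if for every $i\in\mathrm{supp}(\mathbf a)$, writing $x^{\mathbf a}=x^{\mathbf b}x_i$, one has $\mathbf b\in\mathrm{CL}(L)$. (In particular $1\in \mathrm{IT}(L)$.) **Parity check matrix and syndrome.** $H$ is a real $n\times s$ matrix such that for every $\mathbf c\in\mathbb{Z}^n$: $\mathbf cH\in\mathbb{Z}^s$ if and only if the class of $\mathbf c$ in $G$ belongs to $L$. (For the label code of a lattice $\Lambda$ it is the product of the diagonal matrix of determinants of the one-dimensional projections of $\Lambda$ with the transpose of a generator matrix of the dual lattice.) For a monomial put $\xi(x^{\mathbf a})=\mathrm{frac}(\mathbf aH)$, the vector of fractional parts in $[0,1)$; thus $\xi(x^{\mathbf a})=\xi(x^{\mathbf b})$ if and only if the class of $\mathbf a-\mathbf b$ in $G$ lies in $L$. **Algorithm.** $List$ is a finite set of monomials, kept in increasing order with respect to $\prec$. $NextTerm[List]$ removes the $\prec$-smallest monomial from $List$ and returns it. $InsertNext[w,List]$ inserts $x_1w,\dots,x_nw$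 in $List$ (without repetition). 1. Initialize $\mathcal{B}:=\emptyset$, $List:=\{1\}$, $r:=0$. 2. While $List\neq\emptyset$: let $w:=NextTerm[List]$. If $w\notin\mathrm{IT}(L)$, do nothing more with $w$. If $w\in \mathrm{IT}(L)$, set $c:=\mathrm{False}$ and $v':=\xi(w)$ and: - (a) If $v'=v_j$ for some $j\in\{1,\dots,r\}$: if $\deg(w_{j1})\neq0$ and $\deg(w)=\deg(w_{j1})$, then perform $InsertNext[w,List]$, set $N_j:=N_j\cup\{w\}$ and $c:=\mathrm{True}$. Then, for every element $w_{ji}$ of $N_j$ with $w_{ji}\neq w$, add $w-w_{ji}$ to $\mathcal{B}$, and if $c=\mathrm{True}$ also add $w_{ji}-w$ to $\mathcal{B}$. (The elements of $N_j$ are denoted $w_{j1},w_{j2},\dots$ in order of insertion.) - (b) If $v'\notin\{v_1,\dots,v_r\}$: set $r:=r+1$, $v_r:=v'$, $w_{r1}:=w$, $N_r:=\{w_{r1}\}$, and perform $InsertNext[w_{r1},List]$. 3. Return $\mathcal{B}$. *)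

theory Defs
  imports
    "HOL-Analysis.Analysis"
    "HOL-Algebra.Product_Groups"
    "HOL-Library.Poly_Mapping"
    "HOL-Library.Z2"
    "HOL-Library.While_Combinator"
begin

section \<open>Monomials and binomials\<close>

text \<open>
  A monomial \<open>x\<^sup>a\<close> in the variables indexed by \<open>'n\<close> is represented by its exponent vector.
  Hence the monomial \<open>1\<close> is the vector \<open>0\<close>, the product of two monomials is the sum \<open>u + v\<close>
  of the vectors, and \<open>x\<^sub>i\<close> is \<open>axis i 1\<close>. (The pointwise product and the all-ones
  vector \<open>1\<close> that the library provides on vectors play no role.) With the convolution product
  of \<^theory>\<open>HOL-Library.Poly_Mapping\<close>, the finitely supported functions from exponent vectors to
  the two-element field \<^typ>\<open>bit\<close> form the polynomial ring in these variables over that field.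
\<close>

type_synonym 'n monomial = "nat ^ 'n"

type_synonym 'n polynomial = "(nat ^ 'n) \<Rightarrow>\<^sub>0 bit"

definition mono_poly :: "'n::finite monomial \<Rightarrow> 'n polynomial" where
  "mono_poly a = Poly_Mapping.single a 1"

definition total_degree :: "'n::finite monomial \<Rightarrow> nat" where
  "total_degree a = (\<Sum>i\<in>UNIV. a $ i)"

definition supp :: "'n::finite monomial \<Rightarrow> 'n set" where
  "supp a = {i. a $ i \<noteq> 0}"

text \<open>The relation \<open>prec\<close> is the strict part of the term ordering.\<close>

definition admissible_ordering :: "('n::finite monomial \<Rightarrow> 'n monomial \<Rightarrow> bool) \<Rightarrow> bool" where
  "admissible_ordering prec \<longleftrightarrow>
     irreflp prec \<and> transp prec \<and> totalp prec \<and>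
     (\<forall>u. u \<noteq> 0 \<longrightarrow> prec 0 u) \<and>
     (\<forall>u v w. prec u v \<longrightarrow> prec (u + w) (v + w))"

definition total_degree_compatible :: "('n::finite monomial \<Rightarrow> 'n monomial \<Rightarrow> bool) \<Rightarrow> bool" where
  "total_degree_compatible prec \<longleftrightarrow>
     (\<forall>u v. total_degree u < total_degree v \<longrightarrow> prec u v)"


section \<open>Coset leaders and irredundant terms\<close>

text \<open>
  The elements of \<open>ambient_group g\<close> are the functions \<open>a\<close> with \<open>0 \<le> a i < g i\<close> for all
  \<open>i\<close>, provided that every \<open>g i\<close> is positive; they are their own vectors of integer
  representatives.
\<close>

definition ambient_group :: "('n::finite \<Rightarrow> nat) \<Rightarrow> ('n \<Rightarrow> int) monoid" where
  "ambient_group g = product_group UNIV (\<lambda>i. integer_mod_group (g i))"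

definition residue_class :: "('n::finite \<Rightarrow> nat) \<Rightarrow> int ^ 'n \<Rightarrow> ('n \<Rightarrow> int)" where
  "residue_class g c = (\<lambda>i. (c $ i) mod int (g i))"

definition mono_class :: "('n::finite \<Rightarrow> nat) \<Rightarrow> 'n monomial \<Rightarrow> ('n \<Rightarrow> int)" where
  "mono_class g a = residue_class g (\<chi> i. int (a $ i))"

definition mono_of :: "('n::finite \<Rightarrow> int) \<Rightarrow> 'n monomial" where
  "mono_of b = (\<chi> i. nat (b i))"

definition G_norm :: "('n::finite \<Rightarrow> int) \<Rightarrow> int" where
  "G_norm a = (\<Sum>i\<in>UNIV. a i)"

definition coset_leaders :: "('n::finite \<Rightarrow> nat) \<Rightarrow> ('n \<Rightarrow> int) set \<Rightarrow> ('n \<Rightarrow> int) set" where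
  "coset_leaders g L =
     {a \<in> carrier (ambient_group g). \<forall>b \<in> a <#\<^bsub>ambient_group g\<^esub> L. G_norm a \<le> G_norm b}"

text \<open>The exponent vector \<open>a\<close> is itself a coset leader: reduced, and with class in \<open>CL(L)\<close>.\<close>

definition is_coset_leader ::
    "('n::finite \<Rightarrow> nat) \<Rightarrow> ('n \<Rightarrow> int) set \<Rightarrow> 'n monomial \<Rightarrow> bool" where
  "is_coset_leader g L a \<longleftrightarrow> (\<forall>i. a $ i < g i) \<and> mono_class g a \<in> coset_leaders g L"

definition coset_leaders_of ::
    "('n::finite \<Rightarrow> nat) \<Rightarrow> ('n \<Rightarrow> int) set \<Rightarrow> 'n monomial \<Rightarrow> ('n \<Rightarrow> int) set" where
  "coset_leaders_of g L a =
     {b \<in> coset_leaders g L. b \<in> mono_class g a <#\<^bsub>ambient_group g\<^esub> L}"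

definition irredundant_terms ::
    "('n::finite \<Rightarrow> nat) \<Rightarrow> ('n \<Rightarrow> int) set \<Rightarrow> 'n monomial set" where
  "irredundant_terms g L =
     {a. \<forall>i \<in> supp a. \<forall>b. a = b + axis i 1 \<longrightarrow> is_coset_leader g L b}"

definition ECrGb :: "('n::finite \<Rightarrow> nat) \<Rightarrow> ('n \<Rightarrow> int) set \<Rightarrow> 'n polynomial set" where
  "ECrGb g L =
     {mono_poly a - mono_poly (mono_of b) | a b.
        a \<in> irredundant_terms g L \<and> b \<in> coset_leaders_of g L a \<and> a \<noteq> mono_of b}"


section \<open>Parity check matrix and syndrome\<close>

definition parity_check_matrix ::
    "('n::finite \<Rightarrow> nat) \<Rightarrow> ('n \<Rightarrow> int) set \<Rightarrow> real ^ 's::finite ^ 'n \<Rightarrow> bool" where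
  "parity_check_matrix g L H \<longleftrightarrow>
     (\<forall>c :: int ^ 'n.
        (\<forall>j. ((\<chi> i. real_of_int (c $ i)) v* H) $ j \<in> \<int>) \<longleftrightarrow> residue_class g c \<in> L)"

definition syndrome :: "real ^ 's::finite ^ 'n::finite \<Rightarrow> 'n monomial \<Rightarrow> real ^ 's" where
  "syndrome H a = (\<chi> j. frac (((\<chi> i. real (a $ i)) v* H) $ j))"


section \<open>The algorithm\<close>

text \<open>
  In a state, \<open>todo\<close> is the set \<open>List\<close>, the list \<open>vals\<close> is \<open>v\<^sub>1, \<dots>, v\<^sub>r\<close> and
  \<open>blocks\<close> is \<open>N\<^sub>1, \<dots>, N\<^sub>r\<close>, where each \<open>N\<^sub>j\<close> is the list \<open>w\<^sub>j\<^sub>1, w\<^sub>j\<^sub>2, \<dots>\<close> of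
  its elements in order of insertion. Both lists are indexed from \<open>0\<close>, and \<open>r\<close> is their
  length.
\<close>

record ('n, 's) state =
  result :: "'n polynomial set"
  todo :: "'n monomial set"
  vals :: "(real ^ 's) list"
  blocks :: "'n monomial list list"

definition initial_state :: "('n::finite, 's::finite) state" where
  "initial_state = \<lparr>result = {}, todo = {0}, vals = [], blocks = []\<rparr>"

definition next_term ::
    "('n::finite monomial \<Rightarrow> 'n monomial \<Rightarrow> bool) \<Rightarrow> 'n monomial set \<Rightarrow> 'n monomial" where
  "next_term prec S = (THE w. w \<in> S \<and> (\<forall>u \<in> S. u \<noteq> w \<longrightarrow> prec w u))"

definition insert_next :: "'n::finite monomial \<Rightarrow> 'n monomial set \<Rightarrow> 'n monomial set" where
  "insert_next w S = S \<union> {w + axis i 1 | i. True}"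

text \<open>Step (a): the syndrome of \<open>w\<close> occurs in \<open>vals\<close>, at index \<open>j\<close>.\<close>

definition step_old ::
    "'n::finite monomial \<Rightarrow> nat \<Rightarrow> ('n, 's::finite) state \<Rightarrow> ('n, 's) state" where
  "step_old w j s =
     (let w1 = hd (blocks s ! j);
          c = (total_degree w1 \<noteq> 0 \<and> total_degree w = total_degree w1);
          N = (if c \<and> w \<notin> set (blocks s ! j) then blocks s ! j @ [w] else blocks s ! j)
      in s\<lparr>todo := (if c then insert_next w (todo s) else todo s),
           blocks := (blocks s)[j := N],
           result := result s
             \<union> {mono_poly w - mono_poly u | u. u \<in> set N \<and> u \<noteq> w}
             \<union> (if c then {mono_poly u - mono_poly w | u. u \<in> set N \<and> u \<noteq> w} else {})\<rparr>)"

text \<open>Step (b): the syndrome \<open>v\<close> of \<open>w\<close> is new.\<close>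

definition step_new ::
    "'n::finite monomial \<Rightarrow> real ^ 's::finite \<Rightarrow> ('n, 's) state \<Rightarrow> ('n, 's) state" where
  "step_new w v s =
     s\<lparr>todo := insert_next w (todo s),
       vals := vals s @ [v],
       blocks := blocks s @ [[w]]\<rparr>"

definition loop_body ::
    "('n::finite monomial \<Rightarrow> 'n monomial \<Rightarrow> bool) \<Rightarrow> real ^ 's::finite ^ 'n \<Rightarrow>
     ('n \<Rightarrow> nat) \<Rightarrow> ('n \<Rightarrow> int) set \<Rightarrow> ('n, 's) state \<Rightarrow> ('n, 's) state" where
  "loop_body prec H g L s =
     (let w = next_term prec (todo s);
          s' = s\<lparr>todo := todo s - {w}\<rparr>;
          v = syndrome H w
      in if w \<notin> irredundant_terms g L then s'
         else if v \<in> set (vals s')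
         then step_old w (SOME j. j < length (vals s') \<and> vals s' ! j = v) s'
         else step_new w v s')"

text \<open>
  The value is \<open>None\<close> if the loop does not terminate, and \<open>Some B\<close> if it terminates and
  returns \<open>B\<close>. The arguments \<open>g\<close> and \<open>L\<close> are used only for the test for membership in
  \<open>IT(L)\<close>.
\<close>

definition ecrgb_algorithm ::
    "('n::finite monomial \<Rightarrow> 'n monomial \<Rightarrow> bool) \<Rightarrow> real ^ 's::finite ^ 'n \<Rightarrow>
     ('n \<Rightarrow> nat) \<Rightarrow> ('n \<Rightarrow> int) set \<Rightarrow> 'n polynomial set option" where
  "ecrgb_algorithm prec H g L =
     map_option result
       (while_option (\<lambda>s. todo s \<noteq> {}) (loop_body prec H g L) initial_state)"

end

theory Submission
  imports Defs
begin

text \<open>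
  Two monomials lie in the same coset of \<open>L\<close> iff they have the same syndrome, so a monomial is a
  coset leader iff its total degree is minimal among all monomials with its syndrome. Divisors of
  coset leaders are then coset leaders, so every irredundant term other than \<open>1\<close> is a variable
  times an irredundant coset leader; hence the algorithm meets all irredundant terms, in increasing
  order. The first one with a given syndrome is a coset leader, and the blocks contain exactly the
  coset leaders met so far. The terms to be visited lie in the finite set of the monomial \<open>1\<close> and
  the products of a coset leader with a variable, which gives termination.
\<close>

section \<open>Monomials\<close>

lemma total_degree_add: "total_degree (a + b) = total_degree a + total_degree b"
  by (simp add: total_degree_def sum.distrib)

lemma total_degree_axis: "total_degree (axis i k) = k"
  by (simp add: total_degree_def axis_def)

lemma total_degree_eq_0_iff: "total_degree a = 0 \<longleftrightarrow> a = 0"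
  by (simp add: total_degree_def vec_eq_iff)

text \<open>The bound keeps the truncated subtraction of exponents exact.\<close>

lemma mono_eq_add_axis_diff:
  fixes a :: "'n::finite monomial"
  assumes "k \<le> a $ i"
  shows "a = (a - axis i k) + axis i k"
  using assms by (simp add: vec_eq_iff axis_def)

lemma irredundant_terms_iff:
  "a \<in> irredundant_terms g L \<longleftrightarrow> (\<forall>b i. a = b + axis i 1 \<longrightarrow> is_coset_leader g L b)"
proof -
  have "i \<in> supp (b + axis i 1)" for b :: "'a monomial" and i
    by (simp add: supp_def axis_def)
  then show ?thesis
    unfolding irredundant_terms_def by blast
qed

section \<open>Cosets and syndromes\<close>

lemma frac_eq_iff: "frac x = frac y \<longleftrightarrow> x - y \<in> \<int>" for x y :: real
proof
  assume "frac x = frac y"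
  then have "x - y = of_int (\<lfloor>x\<rfloor> - \<lfloor>y\<rfloor>)"
    by (simp add: frac_def)
  then show "x - y \<in> \<int>"
    by (metis Ints_of_int)
next
  assume "x - y \<in> \<int>"
  then obtain k where "x = y + of_int k"
    by (metis Ints_cases add.commute diff_add_cancel)
  then show "frac x = frac y"
    by (simp add: frac_def)
qed

locale lattice_code =
  fixes g :: "'n::finite \<Rightarrow> nat"
    and L :: "('n \<Rightarrow> int) set"
    and H :: "real ^ 's::finite ^ 'n"
  assumes g_pos: "0 < g i"
    and subgroup_L: "subgroup L (ambient_group g)"
    and parity_check: "parity_check_matrix g L H"
begin

section \<open>Reduced integer representatives of the group elements\<close>

lemma carrier_ambient: "b \<in> carrier (ambient_group g) \<longleftrightarrow> (\<forall>i. 0 \<le> b i \<and> b i < int (g i))"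
  using g_pos
  by (auto simp: ambient_group_def carrier_integer_mod_group PiE_def Pi_def)

lemma mult_ambient: "x \<otimes>\<^bsub>ambient_group g\<^esub> y = (\<lambda>i. (x i + y i) mod int (g i))"
  by (simp add: ambient_group_def restrict_UNIV)

lemma mono_class_apply: "mono_class g a i = int (a $ i) mod int (g i)"
  by (simp add: mono_class_def residue_class_def)

lemma mono_class_in_carrier: "mono_class g a \<in> carrier (ambient_group g)"
  using g_pos by (simp add: carrier_ambient mono_class_apply)

lemma mono_of_apply:
  assumes "b \<in> carrier (ambient_group g)"
  shows "int (mono_of b $ i) = b i" "mono_of b $ i < g i"
  using assms carrier_ambient[of b] by (auto simp: mono_of_def nat_less_iff)

lemma mono_class_mono_of: "b \<in> carrier (ambient_group g) \<Longrightarrow> mono_class g (mono_of b) = b"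
  using carrier_ambient[of b] by (auto simp: mono_class_apply mono_of_apply)

lemma mono_of_mono_class: "(\<And>i. a $ i < g i) \<Longrightarrow> mono_of (mono_class g a) = a"
  by (simp add: mono_of_def mono_class_apply vec_eq_iff)

lemma G_norm_eq_total_degree:
  "b \<in> carrier (ambient_group g) \<Longrightarrow> G_norm b = int (total_degree (mono_of b))"
  by (simp add: G_norm_def total_degree_def mono_of_apply)

text \<open>Multiplication by \<open>H\<close> is linear, and equal fractional parts mean an
  integral difference, so the parity check condition applies to the difference vector. That vector
  is formed in the integers, where subtraction does not truncate.\<close>

lemma syndrome_eq_iff:
  "syndrome H a = syndrome H b \<longleftrightarrow> residue_class g (\<chi> i. int (a $ i) - int (b $ i)) \<in> L"
proof -
  have "((\<chi> i. real_of_int ((\<chi> i. int (a $ i) - int (b $ i)) $ i)) v* H)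
    = ((\<chi> i. real (a $ i)) v* H) - ((\<chi> i. real (b $ i)) v* H)"
    by (simp add: vec_eq_iff vector_matrix_mult_def sum_subtractf algebra_simps)
  then show ?thesis
    using parity_check[unfolded parity_check_matrix_def, rule_format,
        of "\<chi> i. int (a $ i) - int (b $ i)"]
    by (simp add: syndrome_def vec_eq_iff frac_eq_iff)
qed

lemma syndrome_add_cong:
  "syndrome H a = syndrome H b \<Longrightarrow> syndrome H (a + c) = syndrome H (b + c)"
  by (simp add: syndrome_eq_iff)

lemma syndrome_add_axis: "syndrome H (a + axis i (g i)) = syndrome H a"
proof -
  \<comment> \<open>The shift by \<open>g i\<close> vanishes modulo \<open>g i\<close>. The class on
    the right is in \<open>L\<close>, by \<open>syndrome_eq_iff\<close> for \<open>a\<close> and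
    \<open>a\<close>.\<close>
  have "residue_class g (\<chi> k. int ((a + axis i (g i)) $ k) - int (a $ k))
      = residue_class g (\<chi> k. int (a $ k) - int (a $ k))"
    by (auto simp: residue_class_def axis_def)
  then show ?thesis
    using syndrome_eq_iff by metis
qed

text \<open>In the group, the equation \<open>b = mono_class g a \<otimes> l\<close> has exactly one
  solution \<open>l\<close>, the residue class \<open>d\<close> of the difference of the exponents.
  So membership in the coset amounts to \<open>d \<in> L\<close>, which is equality of
  syndromes.\<close>

lemma mem_coset_iff:
  assumes b: "b \<in> carrier (ambient_group g)"
  shows "b \<in> mono_class g a <#\<^bsub>ambient_group g\<^esub> L \<longleftrightarrow> syndrome H (mono_of b) = syndrome H a"
proof -
  define d where "d = residue_class g (\<chi> i. int (mono_of b $ i) - int (a $ i))"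
  have d: "d i = (b i - int (a $ i)) mod int (g i)" for i
    by (simp add: d_def residue_class_def mono_of_apply[OF b])
  have "l = d" if "l \<in> L" and eq: "b = mono_class g a \<otimes>\<^bsub>ambient_group g\<^esub> l" for l
  proof
    fix i
    have l: "0 \<le> l i \<and> l i < int (g i)"
      using subgroup.mem_carrier[OF subgroup_L \<open>l \<in> L\<close>] carrier_ambient by blast
    have "b i = (int (a $ i) mod int (g i) + l i) mod int (g i)"
      using fun_cong[OF eq, of i] unfolding mult_ambient mono_class_apply .
    then show "l i = d i"
      using l by (simp add: d mod_simps)
  qed
  moreover have "b = mono_class g a \<otimes>\<^bsub>ambient_group g\<^esub> d"
  proof
    fix i
    have "0 \<le> b i \<and> b i < int (g i)"
      using b carrier_ambient by blast
    then show "b i = (mono_class g a \<otimes>\<^bsub>ambient_group g\<^esub> d) i"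
      by (simp add: mult_ambient mono_class_apply d mod_simps)
  qed
  ultimately have "b \<in> mono_class g a <#\<^bsub>ambient_group g\<^esub> L \<longleftrightarrow> d \<in> L"
    unfolding l_coset_def by blast
  then show ?thesis
    by (simp add: syndrome_eq_iff d_def)
qed

text \<open>A monomial and its reduction have the same class and so define the same coset. With the
  reduction as base point, \<open>mem_coset_iff\<close> has a trivial right side, so the class lies
  in that coset; with \<open>a\<close> as base point, it then yields the claim.\<close>

lemma syndrome_mono_class: "syndrome H (mono_of (mono_class g a)) = syndrome H a"
proof -
  have "mono_class g (mono_of (mono_class g a)) = mono_class g a"
    by (rule mono_class_mono_of[OF mono_class_in_carrier])
  then show ?thesis
    using mem_coset_iff[OF mono_class_in_carrier, of a a]
      mem_coset_iff[OF mono_class_in_carrier, of a "mono_of (mono_class g a)"]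
    by simp
qed

lemma total_degree_mono_class_le: "total_degree (mono_of (mono_class g a)) \<le> total_degree a"
  unfolding total_degree_def
  by (intro sum_mono) (simp add: mono_of_def mono_class_apply flip: of_nat_mod)

text \<open>Reducing exponents modulo \<open>g\<close> keeps the syndrome and never raises the
  degree, so a leader also beats the unreduced monomials. Conversely, a monomial of minimal degree
  is reduced: otherwise lowering some exponent by \<open>g i > 0\<close> would keep the syndrome and
  lower the degree.\<close>

lemma is_coset_leader_iff:
  "is_coset_leader g L a \<longleftrightarrow>
    (\<forall>b. syndrome H b = syndrome H a \<longrightarrow> total_degree a \<le> total_degree b)"
  (is "_ \<longleftrightarrow> ?minimal")
proof
  assume leader: "is_coset_leader g L a"
  then have reduced: "mono_of (mono_class g a) = a"
    by (simp add: is_coset_leader_def mono_of_mono_class)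
  show ?minimal
  proof (intro allI impI)
    fix b
    assume "syndrome H b = syndrome H a"
    then have "mono_class g b \<in> mono_class g a <#\<^bsub>ambient_group g\<^esub> L"
      by (simp add: mem_coset_iff mono_class_in_carrier syndrome_mono_class)
    then have "G_norm (mono_class g a) \<le> G_norm (mono_class g b)"
      using leader by (simp add: is_coset_leader_def coset_leaders_def)
    then have "total_degree a \<le> total_degree (mono_of (mono_class g b))"
      by (simp add: G_norm_eq_total_degree mono_class_in_carrier reduced)
    then show "total_degree a \<le> total_degree b"
      using total_degree_mono_class_le order_trans by blast
  qed
next
  assume minimal: ?minimal
  have reduced: "a $ i < g i" for i
  proof (rule ccontr)
    assume "\<not> a $ i < g i"
    then have a: "a = (a - axis i (g i)) + axis i (g i)"
      by (intro mono_eq_add_axis_diff) simp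
    then have "syndrome H (a - axis i (g i)) = syndrome H a"
      using syndrome_add_axis by metis
    then have "total_degree a \<le> total_degree (a - axis i (g i))"
      using minimal by blast
    moreover have "total_degree a = total_degree (a - axis i (g i)) + g i"
      using a total_degree_add total_degree_axis by metis
    ultimately show False
      using g_pos[of i] by simp
  qed
  have "G_norm (mono_class g a) \<le> G_norm b"
    if b: "b \<in> mono_class g a <#\<^bsub>ambient_group g\<^esub> L" for b
  proof -
    have "b \<in> carrier (ambient_group g)"
      using b g_pos by (auto simp: l_coset_def mult_ambient carrier_ambient)
    then show ?thesis
      using minimal b
      by (simp add: mem_coset_iff G_norm_eq_total_degree mono_class_in_carrier
          mono_of_mono_class reduced)
  qed
  then show "is_coset_leader g L a"
    by (simp add: is_coset_leader_def coset_leaders_def mono_class_in_carrier reduced)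
qed

section \<open>Finiteness, existence and divisors of coset leaders\<close>

lemma finite_coset_leaders: "finite {a. is_coset_leader g L a}"
proof (rule finite_subset)
  \<comment> \<open>Leaders are reduced. The box is deliberately coarse: all coordinates share one
    finite range, the union of the intervals.\<close>
  show "{a. is_coset_leader g L a} \<subseteq> mono_of ` (UNIV \<rightarrow>\<^sub>E (\<Union>i. {0..int (g i)}))"
  proof
    fix a
    assume "a \<in> {a. is_coset_leader g L a}"
    then have a: "a $ i < g i" for i
      by (simp add: is_coset_leader_def)
    have "a = mono_of (\<lambda>i. int (a $ i))"
      by (simp add: mono_of_def vec_eq_iff)
    moreover have "(\<lambda>i. int (a $ i)) \<in> UNIV \<rightarrow>\<^sub>E (\<Union>i. {0..int (g i)})"
      using a by (fastforce intro: less_imp_le)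
    ultimately show "a \<in> mono_of ` (UNIV \<rightarrow>\<^sub>E (\<Union>i. {0..int (g i)}))"
      by blast
  qed
  show "finite (mono_of ` (UNIV \<rightarrow>\<^sub>E (\<Union>i. {0..int (g i)})) :: 'n monomial set)"
    by (intro finite_imageI finite_PiE) auto
qed

lemma ex_coset_leader: "\<exists>u. is_coset_leader g L u \<and> syndrome H u = syndrome H a"
  using ex_has_least_nat[of "\<lambda>u. syndrome H u = syndrome H a" a total_degree]
  by (metis is_coset_leader_iff)

text \<open>A competitor \<open>c\<close> of \<open>b\<close>, multiplied by the same variable,
  competes with \<open>b + axis i 1\<close>; both degrees rise by one.\<close>

lemma is_coset_leader_divisor:
  assumes "is_coset_leader g L (b + axis i 1)"
  shows "is_coset_leader g L b"
  unfolding is_coset_leader_iff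
proof (intro allI impI)
  fix c
  assume "syndrome H c = syndrome H b"
  then have "total_degree (b + axis i 1) \<le> total_degree (c + axis i 1)"
    using assms syndrome_add_cong by (metis is_coset_leader_iff)
  then show "total_degree b \<le> total_degree c"
    by (simp add: total_degree_add)
qed

lemma coset_leader_irredundant: "is_coset_leader g L a \<Longrightarrow> a \<in> irredundant_terms g L"
  using is_coset_leader_divisor by (auto simp: irredundant_terms_iff)

text \<open>Passes from group elements to monomials, so that the rest of the proof can argue with
  degrees and syndromes alone.\<close>

lemma mem_coset_leaders_of_iff:
  "b \<in> coset_leaders_of g L a \<longleftrightarrow>
    (\<exists>u. b = mono_class g u \<and> is_coset_leader g L u \<and> syndrome H u = syndrome H a)"
proof
  assume b: "b \<in> coset_leaders_of g L a"
  then have carrier: "b \<in> carrier (ambient_group g)"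
    by (simp add: coset_leaders_of_def coset_leaders_def)
  then have "b = mono_class g (mono_of b)"
    by (simp add: mono_class_mono_of)
  moreover have "is_coset_leader g L (mono_of b)"
    using b carrier
    by (simp add: is_coset_leader_def mono_of_apply mono_class_mono_of coset_leaders_of_def)
  moreover have "syndrome H (mono_of b) = syndrome H a"
    using b carrier by (simp add: coset_leaders_of_def mem_coset_iff)
  ultimately show "\<exists>u. b = mono_class g u \<and> is_coset_leader g L u \<and> syndrome H u = syndrome H a"
    by blast
next
  assume "\<exists>u. b = mono_class g u \<and> is_coset_leader g L u \<and> syndrome H u = syndrome H a"
  then show "b \<in> coset_leaders_of g L a"
    by (auto simp: coset_leaders_of_def is_coset_leader_def mem_coset_iff
        mono_class_in_carrier syndrome_mono_class)
qed

text \<open>The binomials that the algorithm has produced once it has met the terms in \<open>P\<close>.\<close>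

definition binomials :: "'n monomial set \<Rightarrow> 'n polynomial set" where
  "binomials P = {mono_poly a - mono_poly u | a u.
     a \<in> P \<and> u \<in> P \<and> is_coset_leader g L u \<and> syndrome H u = syndrome H a \<and> a \<noteq> u}"

text \<open>Every coset leader is irredundant, so the second term of each binomial in
  \<open>ECrGb g L\<close> meets the membership condition in \<open>binomials\<close>.\<close>

lemma ECrGb_eq_binomials: "ECrGb g L = binomials (irredundant_terms g L)"
proof -
  have reduced: "mono_of (mono_class g u) = u" if "is_coset_leader g L u" for u
    using that by (simp add: is_coset_leader_def mono_of_mono_class)
  show ?thesis
    unfolding ECrGb_def binomials_def mem_coset_leaders_of_iff
    by (rule Collect_cong) (metis reduced coset_leader_irredundant)
qed

text \<open>The two added sets have \<open>w\<close> as first and as second term; they match the two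
  additions to the result in step (a).\<close>

lemma binomials_insert:
  "binomials (insert w P) = binomials P
    \<union> {mono_poly w - mono_poly u | u.
         u \<in> P \<and> is_coset_leader g L u \<and> syndrome H u = syndrome H w \<and> u \<noteq> w}
    \<union> {mono_poly a - mono_poly w | a.
         a \<in> P \<and> is_coset_leader g L w \<and> syndrome H w = syndrome H a \<and> a \<noteq> w}"
  (is "?lhs = ?rhs")
proof
  show "?lhs \<subseteq> ?rhs"
  proof
    fix p
    assume "p \<in> ?lhs"
    then obtain a u where "p = mono_poly a - mono_poly u" "a \<in> insert w P" "u \<in> insert w P"
        "is_coset_leader g L u" "syndrome H u = syndrome H a" "a \<noteq> u"
      unfolding binomials_def by blast
    then show "p \<in> ?rhs"
      unfolding binomials_def by (cases "a = w"; cases "u = w") blast+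
  qed
  show "?rhs \<subseteq> ?lhs"
    unfolding binomials_def by blast
qed

end

section \<open>The loop\<close>

locale ordered_lattice_code = lattice_code g L H
  for g :: "'n::finite \<Rightarrow> nat" and L and H :: "real ^ 's::finite ^ 'n" +
  fixes prec :: "'n monomial \<Rightarrow> 'n monomial \<Rightarrow> bool"
  assumes admissible: "admissible_ordering prec"
    and degree_compatible: "total_degree_compatible prec"
begin

section \<open>The term ordering and its least elements\<close>

lemma prec_irrefl: "\<not> prec u u"
  using admissible by (auto simp: admissible_ordering_def irreflp_def)

lemma prec_trans: "prec u v \<Longrightarrow> prec v w \<Longrightarrow> prec u w"
  using admissible by (auto simp: admissible_ordering_def dest: transpD)

lemma prec_total: "u \<noteq> v \<Longrightarrow> prec u v \<or> prec v u"
  using admissible by (auto simp: admissible_ordering_def dest: totalpD)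

lemma prec_if_degree_less: "total_degree u < total_degree v \<Longrightarrow> prec u v"
  using degree_compatible by (simp add: total_degree_compatible_def)

lemma degree_le_if_prec: "prec u v \<Longrightarrow> total_degree u \<le> total_degree v"
  by (meson not_le prec_if_degree_less prec_irrefl prec_trans)

lemma prec_add_axis: "prec u (u + axis i 1)"
  by (simp add: prec_if_degree_less total_degree_add total_degree_axis)

lemma ex_least:
  assumes "finite S" "S \<noteq> {}"
  shows "\<exists>w\<in>S. \<forall>u\<in>S. u \<noteq> w \<longrightarrow> prec w u"
  using assms
proof (induction rule: finite_ne_induct)
  case (insert x F)
  then obtain w where "w \<in> F" "\<forall>u\<in>F. u \<noteq> w \<longrightarrow> prec w u"
    by blast
  then show ?case
    using prec_total[of w x] prec_trans by (metis insertE insertI1 insertI2)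
qed simp

lemma next_term:
  assumes "finite S" "S \<noteq> {}"
  shows "next_term prec S \<in> S" "\<And>u. u \<in> S \<Longrightarrow> u \<noteq> next_term prec S \<Longrightarrow> prec (next_term prec S) u"
proof -
  have "\<exists>!w. w \<in> S \<and> (\<forall>u\<in>S. u \<noteq> w \<longrightarrow> prec w u)"
  proof -
    obtain w where w: "w \<in> S" "\<And>u. u \<in> S \<Longrightarrow> u \<noteq> w \<Longrightarrow> prec w u"
      using ex_least[OF assms] by blast
    have "v = w" if "v \<in> S" "\<forall>u\<in>S. u \<noteq> v \<longrightarrow> prec v u" for v
    proof (rule ccontr)
      assume "v \<noteq> w"
      then have "prec v w" "prec w v"
        using w that by auto
      then show False
        using prec_irrefl prec_trans by blast
    qed
    with w show ?thesis
      by blast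
  qed
  from theI'[OF this]
  show "next_term prec S \<in> S" "\<And>u. u \<in> S \<Longrightarrow> u \<noteq> next_term prec S \<Longrightarrow> prec (next_term prec S) u"
    unfolding next_term_def by blast+
qed

section \<open>The invariant of the loop\<close>

definition candidates :: "'n monomial set" where
  "candidates = insert 0 (\<Union>i. (\<lambda>u. u + axis i 1) ` {u. is_coset_leader g L u})"

text \<open>Bounds the queue: only visited coset leaders have their multiples inserted.\<close>

lemma finite_candidates: "finite candidates"
  by (simp add: candidates_def finite_coset_leaders)

text \<open>Here \<open>P\<close> is the set of irredundant terms met so far.\<close>

definition queue_inv :: "'n monomial set \<Rightarrow> 'n monomial set \<Rightarrow> bool" where
  "queue_inv P Q \<longleftrightarrow>
     P \<subseteq> irredundant_terms g L \<and> Q \<subseteq> candidates \<and>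
     (\<forall>u\<in>P. \<forall>t\<in>Q. prec u t) \<and>
     0 \<in> P \<union> Q \<and>
     (\<forall>u\<in>P. \<forall>i. is_coset_leader g L u \<longrightarrow> u + axis i 1 \<in> irredundant_terms g L
        \<longrightarrow> u + axis i 1 \<in> P \<union> Q)"

text \<open>The values are the syndromes of all terms met, whereas the blocks hold only the coset
  leaders among them. Nonempty blocks give \<open>hd\<close> a meaning and supply a leader for each
  value; distinct values make the index of a syndrome unique.\<close>

definition block_inv :: "'n monomial set \<Rightarrow> (real ^ 's) list \<Rightarrow> 'n monomial list list \<Rightarrow> bool" where
  "block_inv P vs Ns \<longleftrightarrow>
     length Ns = length vs \<and> distinct vs \<and> set vs = syndrome H ` P \<and>
     (\<forall>j < length vs. Ns ! j \<noteq> [] \<and>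
        set (Ns ! j) = {u \<in> P. is_coset_leader g L u \<and> syndrome H u = vs ! j})"

text \<open>\<open>P\<close> is quantified because it is not a component of the state: irredundant
  terms that are not leaders enter no block.\<close>

definition loop_inv :: "('n, 's) state \<Rightarrow> bool" where
  "loop_inv s \<longleftrightarrow>
     (\<exists>P. queue_inv P (todo s) \<and> block_inv P (vals s) (blocks s) \<and> result s = binomials P)"

text \<open>Dividing \<open>u\<close> by a variable leaves a coset leader, which is irredundant and
  precedes the queue too, hence was met by induction on the degree. The invariant then puts
  \<open>u\<close> in \<open>P \<union> Q\<close>, and \<open>u \<in> Q\<close> would give
  \<open>prec u u\<close>.\<close>

lemma queue_inv_smaller_met:
  assumes inv: "queue_inv P Q"
    and "u \<in> irredundant_terms g L" and "\<And>t. t \<in> Q \<Longrightarrow> prec u t"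
  shows "u \<in> P"
  using assms(2,3)
proof (induction "total_degree u" arbitrary: u rule: less_induct)
  case less
  show ?case
  proof (cases "u = 0")
    case True
    then show ?thesis
      using inv less.prems(2) prec_irrefl by (auto simp: queue_inv_def)
  next
    case False
    then obtain i where "u $ i \<noteq> 0"
      by (auto simp: vec_eq_iff)
    then obtain b where u: "u = b + axis i 1"
      using mono_eq_add_axis_diff[of 1 u i] by auto
    have b: "is_coset_leader g L b"
      using less.prems(1) u irredundant_terms_iff by blast
    have "b \<in> P"
    proof (rule less.hyps)
      show "total_degree b < total_degree u"
        by (simp add: u total_degree_add total_degree_axis)
      show "b \<in> irredundant_terms g L"
        by (rule coset_leader_irredundant[OF b])
      show "prec b t" if "t \<in> Q" for t
        using less.prems(2)[OF that] prec_add_axis prec_trans unfolding u by blast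
    qed
    then have "u \<in> P \<union> Q"
      using inv b less.prems(1) by (auto simp: queue_inv_def u)
    then show ?thesis
      using less.prems(2) prec_irrefl by blast
  qed
qed

section \<open>Preservation of the invariant by one pass of the loop\<close>

lemma queue_inv_not_met: "queue_inv P Q \<Longrightarrow> w \<in> Q \<Longrightarrow> w \<notin> P"
  using prec_irrefl unfolding queue_inv_def by blast

lemma queue_inv_redundant:
  "queue_inv P Q \<Longrightarrow> w \<notin> irredundant_terms g L \<Longrightarrow> queue_inv P (Q - {w})"
proof -
  assume inv: "queue_inv P Q" and w: "w \<notin> irredundant_terms g L"
  \<comment> \<open>The term \<open>0\<close> has empty support and is therefore irredundant, so
    removing \<open>w\<close> keeps \<open>0\<close> in \<open>P \<union> Q\<close>.\<close>
  have "w \<noteq> 0"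
    using w by (auto simp: irredundant_terms_def supp_def)
  then show ?thesis
    using inv w by (auto simp: queue_inv_def)
qed

text \<open>Serves both steps of the algorithm: in (a) the flag \<open>c\<close> turns out to say
  that \<open>w\<close> is a coset leader, and in (b) \<open>w\<close> always is one. The new queue
  lies after \<open>w\<close>, the old terms by minimality of \<open>w\<close> and the multiples of
  \<open>w\<close> by degree.\<close>

lemma queue_inv_step:
  assumes inv: "queue_inv P Q" and "w \<in> Q" and w: "w \<in> irredundant_terms g L"
    and least: "\<And>u. u \<in> Q \<Longrightarrow> u \<noteq> w \<Longrightarrow> prec w u"
  shows "queue_inv (insert w P)
    (if is_coset_leader g L w then insert_next w (Q - {w}) else Q - {w})"
    (is "queue_inv _ ?Q")
proof -
  have P_w: "prec u w" if "u \<in> P" for u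
    using inv \<open>w \<in> Q\<close> that by (auto simp: queue_inv_def)
  have Q: "t \<in> Q - {w} \<or> is_coset_leader g L w \<and> (\<exists>i. t = w + axis i 1)" if "t \<in> ?Q" for t
    using that by (auto simp: insert_next_def split: if_splits)
  have w_Q: "prec w t" if "t \<in> ?Q" for t
    using Q[OF that] least prec_add_axis by blast
  have "?Q \<subseteq> candidates"
  proof
    fix t
    assume "t \<in> ?Q"
    from Q[OF this] show "t \<in> candidates"
      using inv unfolding queue_inv_def candidates_def by blast
  qed
  moreover have "\<forall>u\<in>insert w P. \<forall>t\<in>?Q. prec u t"
    using P_w w_Q prec_trans by blast
  \<comment> \<open>Only \<open>w\<close> leaves the queue, and it moves to the set of terms
    met.\<close>
  moreover have "Q \<subseteq> insert w ?Q"
    by (auto simp: insert_next_def)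
  then have "0 \<in> insert w P \<union> ?Q"
    using inv by (auto simp: queue_inv_def)
  moreover have "u + axis i 1 \<in> insert w P \<union> ?Q"
    if "u \<in> insert w P" "is_coset_leader g L u" "u + axis i 1 \<in> irredundant_terms g L" for u i
  proof (cases "u = w")
    case True
    then show ?thesis
      using that(2) by (auto simp: insert_next_def)
  next
    case False
    then have "u + axis i 1 \<in> P \<union> Q"
      using inv that unfolding queue_inv_def by blast
    then show ?thesis
      using \<open>Q \<subseteq> insert w ?Q\<close> by blast
  qed
  ultimately show ?thesis
    using inv w unfolding queue_inv_def by blast
qed

text \<open>Otherwise a leader with the same syndrome has smaller degree, so it precedes
  \<open>w\<close> and the whole queue and has been met; the syndrome would not be new.\<close>

lemma new_syndrome_leader:
  assumes inv: "queue_inv P Q" and w: "w \<in> irredundant_terms g L"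
    and least: "\<And>u. u \<in> Q \<Longrightarrow> u \<noteq> w \<Longrightarrow> prec w u"
    and new: "syndrome H w \<notin> syndrome H ` P"
  shows "is_coset_leader g L w"
proof (rule ccontr)
  assume not_leader: "\<not> is_coset_leader g L w"
  obtain u where u: "is_coset_leader g L u" "syndrome H u = syndrome H w"
    using ex_coset_leader by blast
  have "total_degree u < total_degree w"
    using not_leader u by (metis is_coset_leader_iff le_less_trans not_le)
  then have "prec u w"
    by (rule prec_if_degree_less)
  then have "prec u t" if "t \<in> Q" for t
    using least[OF that] prec_trans by blast
  then have "u \<in> P"
    by (rule queue_inv_smaller_met[OF inv coset_leader_irredundant[OF u(1)]])
  then show False
    using new u(2) by (metis imageI)
qed

lemma leader_iff_degree_eq:
  assumes "is_coset_leader g L u" "syndrome H u = syndrome H w"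
  shows "is_coset_leader g L w \<longleftrightarrow> total_degree w = total_degree u"
  using assms by (metis antisym is_coset_leader_iff)

lemma loop_inv_step_old:
  assumes inv: "queue_inv P Q" "block_inv P (vals s) (blocks s)" "result s = binomials P"
    and todo: "todo s = Q - {w}"
    and w: "w \<in> Q" "w \<in> irredundant_terms g L"
    and least: "\<And>u. u \<in> Q \<Longrightarrow> u \<noteq> w \<Longrightarrow> prec w u"
    and j: "j < length (vals s)" "vals s ! j = syndrome H w"
  shows "loop_inv (step_old w j s)"
proof -
  define N where "N = blocks s ! j"
  have N: "N \<noteq> []" "set N = {u \<in> P. is_coset_leader g L u \<and> syndrome H u = syndrome H w}"
    using inv(2) j by (auto simp: block_inv_def N_def)
  have "w \<notin> P"
    using queue_inv_not_met[OF inv(1) w(1)] .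
  then have "w \<notin> set N"
    by (simp add: N)
  have hd: "hd N \<in> P" "is_coset_leader g L (hd N)" "syndrome H (hd N) = syndrome H w"
    using N hd_in_set[OF N(1)] by auto
  \<comment> \<open>All leaders with one syndrome have equal degree. For a leader \<open>w\<close>
    that degree is nonzero: otherwise \<open>w\<close> and \<open>hd N\<close> would both be
    \<open>0\<close>, although \<open>hd N \<in> P\<close> and \<open>w \<notin> P\<close>.\<close>
  have c: "total_degree (hd N) \<noteq> 0 \<and> total_degree w = total_degree (hd N)
      \<longleftrightarrow> is_coset_leader g L w"
    using leader_iff_degree_eq[OF hd(2,3)] hd(1) \<open>w \<notin> P\<close> total_degree_eq_0_iff by metis
  define N' where "N' = (if is_coset_leader g L w then N @ [w] else N)"
  have step: "step_old w j s = s\<lparr>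
      todo := (if is_coset_leader g L w then insert_next w (Q - {w}) else Q - {w}),
      blocks := (blocks s)[j := N'],
      result := result s
        \<union> {mono_poly w - mono_poly u | u. u \<in> set N' \<and> u \<noteq> w}
        \<union> (if is_coset_leader g L w
            then {mono_poly u - mono_poly w | u. u \<in> set N' \<and> u \<noteq> w} else {})\<rparr>"
    unfolding step_old_def Let_def N_def[symmetric] c N'_def todo
    using \<open>w \<notin> set N\<close> by simp
  have "block_inv (insert w P) (vals s) ((blocks s)[j := N'])"
    unfolding block_inv_def
  proof (intro conjI allI impI)
    show "length ((blocks s)[j := N']) = length (vals s)" "distinct (vals s)"
      using inv(2) by (auto simp: block_inv_def)
    show "set (vals s) = syndrome H ` insert w P"
      using inv(2) j nth_mem[OF j(1)] by (auto simp: block_inv_def)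
    fix k
    assume k: "k < length (vals s)"
    have len: "length (blocks s) = length (vals s)"
      using inv(2) by (simp add: block_inv_def)
    \<comment> \<open>Distinctness of the values ensures that only block \<open>j\<close> is
      affected by \<open>w\<close>.\<close>
    have other: "vals s ! k \<noteq> syndrome H w" if "k \<noteq> j"
      using inv(2) j k that by (metis block_inv_def nth_eq_iff_index_eq)
    have old: "blocks s ! k \<noteq> []"
      "set (blocks s ! k) = {u \<in> P. is_coset_leader g L u \<and> syndrome H u = vals s ! k}"
      using inv(2) k unfolding block_inv_def by blast+
    show "(blocks s)[j := N'] ! k \<noteq> []"
      using old(1) N(1) k len by (cases "k = j") (simp_all add: N'_def)
    show "set ((blocks s)[j := N'] ! k)
        = {u \<in> insert w P. is_coset_leader g L u \<and> syndrome H u = vals s ! k}"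
    proof (cases "k = j")
      case True
      then show ?thesis
        using N j len by (auto simp: N'_def)
    next
      case False
      then show ?thesis
        unfolding nth_list_update_neq[OF False[symmetric]] old(2)
        using other[OF False] by auto
    qed
  qed
  moreover have "result (step_old w j s) = binomials (insert w P)"
  proof -
    \<comment> \<open>A term met before \<open>w\<close> has at most its degree, which is minimal if
      \<open>w\<close> is a leader. So the block already holds all terms of \<open>P\<close> with
      this syndrome, and the reversed binomials over the block are all those with \<open>w\<close>
      as second term.\<close>
    have "is_coset_leader g L a"
      if "is_coset_leader g L w" "a \<in> P" "syndrome H a = syndrome H w" for a
    proof -
      have "prec a w"
        using inv(1) w(1) that(2) by (auto simp: queue_inv_def)
      then show ?thesis
        using that by (metis degree_le_if_prec is_coset_leader_iff order_trans)
    qed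
    then show ?thesis
      unfolding step binomials_insert inv(3) by (auto simp: N'_def N)
  qed
  ultimately show ?thesis
    unfolding loop_inv_def
    using queue_inv_step[OF inv(1) w least] by (intro exI[of _ "insert w P"]) (simp add: step)
qed

lemma loop_inv_step_new:
  assumes inv: "queue_inv P Q" "block_inv P (vals s) (blocks s)" "result s = binomials P"
    and todo: "todo s = Q - {w}"
    and w: "w \<in> Q" "w \<in> irredundant_terms g L"
    and least: "\<And>u. u \<in> Q \<Longrightarrow> u \<noteq> w \<Longrightarrow> prec w u"
    and new: "syndrome H w \<notin> set (vals s)"
  shows "loop_inv (step_new w (syndrome H w) s)"
proof -
  have P: "syndrome H w \<notin> syndrome H ` P"
    using inv(2) new by (simp add: block_inv_def)
  have leader: "is_coset_leader g L w"
    by (rule new_syndrome_leader[OF inv(1) w(2) least P])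
  have "block_inv (insert w P) (vals s @ [syndrome H w]) (blocks s @ [[w]])"
    unfolding block_inv_def
  proof (intro conjI allI impI)
    fix k
    assume k: "k < length (vals s @ [syndrome H w])"
    have len: "length (blocks s) = length (vals s)"
      using inv(2) by (simp add: block_inv_def)
    consider (old) "k < length (vals s)" | (new) "k = length (vals s)"
      using k by (auto simp: less_Suc_eq)
    then have "(blocks s @ [[w]]) ! k \<noteq> [] \<and> set ((blocks s @ [[w]]) ! k) =
      {u \<in> insert w P. is_coset_leader g L u \<and> syndrome H u = (vals s @ [syndrome H w]) ! k}"
    proof cases
      case old
      then have "vals s ! k \<noteq> syndrome H w"
        using new nth_mem by metis
      then show ?thesis
        using inv(2) old len by (auto simp: block_inv_def nth_append)
    next
      case new
      then show ?thesis
        using P len leader by (auto simp: nth_append image_iff)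
    qed
    then show "(blocks s @ [[w]]) ! k \<noteq> []" "set ((blocks s @ [[w]]) ! k) =
      {u \<in> insert w P. is_coset_leader g L u \<and> syndrome H u = (vals s @ [syndrome H w]) ! k}"
      by blast+
  qed (use inv(2) new in \<open>auto simp: block_inv_def\<close>)
  \<comment> \<open>No term met before shares the syndrome of \<open>w\<close>, so no binomial
    involves \<open>w\<close> yet.\<close>
  moreover have "binomials (insert w P) = binomials P"
    using P unfolding binomials_insert by (auto simp: image_iff)
  ultimately show ?thesis
    unfolding loop_inv_def
    using queue_inv_step[OF inv(1) w least] leader inv(3) todo
    by (intro exI[of _ "insert w P"]) (simp add: step_new_def)
qed

lemma some_index:
  assumes "v \<in> set vs"
  defines "j \<equiv> SOME j. j < length vs \<and> vs ! j = v"
  shows "j < length vs" "vs ! j = v"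
proof -
  have "\<exists>j. j < length vs \<and> vs ! j = v"
    using assms(1) by (simp add: in_set_conv_nth)
  from someI_ex[OF this] show "j < length vs" "vs ! j = v"
    unfolding j_def by blast+
qed

lemma loop_inv_body:
  assumes "loop_inv s" "todo s \<noteq> {}"
  shows "loop_inv (loop_body prec H g L s)"
proof -
  obtain P where inv: "queue_inv P (todo s)" "block_inv P (vals s) (blocks s)"
      "result s = binomials P"
    using assms(1) loop_inv_def by blast
  have "finite (todo s)"
    using inv(1) finite_candidates finite_subset by (auto simp: queue_inv_def)
  define w where "w = next_term prec (todo s)"
  have w: "w \<in> todo s" and least: "\<And>u. u \<in> todo s \<Longrightarrow> u \<noteq> w \<Longrightarrow> prec w u"
    unfolding w_def using next_term[OF \<open>finite (todo s)\<close> assms(2)] by blast+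
  define s' where "s' = s\<lparr>todo := todo s - {w}\<rparr>"
  have s': "block_inv P (vals s') (blocks s')" "result s' = binomials P" "todo s' = todo s - {w}"
    by (simp_all add: s'_def inv)
  have body: "loop_body prec H g L s =
      (if w \<notin> irredundant_terms g L then s'
       else if syndrome H w \<in> set (vals s')
       then step_old w (SOME j. j < length (vals s') \<and> vals s' ! j = syndrome H w) s'
       else step_new w (syndrome H w) s')"
    by (simp only: loop_body_def Let_def w_def[symmetric] s'_def[symmetric])
  consider (redundant) "w \<notin> irredundant_terms g L"
    | (old) "w \<in> irredundant_terms g L" "syndrome H w \<in> set (vals s')"
    | (new) "w \<in> irredundant_terms g L" "syndrome H w \<notin> set (vals s')"
    by blast
  then show ?thesis
  proof cases
    case redundant
    then show ?thesis
      unfolding body loop_inv_def using queue_inv_redundant[OF inv(1)] s' by auto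
  next
    case old
    then show ?thesis
      using loop_inv_step_old[OF inv(1) s' w old(1) least some_index[OF old(2)]] body by simp
  next
    case new
    then show ?thesis
      using loop_inv_step_new[OF inv(1) s' w new(1) least new(2)] body by simp
  qed
qed

section \<open>Termination\<close>

lemma todo_loop_body:
  "todo (loop_body prec H g L s) \<subseteq> todo s - {next_term prec (todo s)}
     \<union> {next_term prec (todo s) + axis i 1 | i. True}"
  by (auto simp: loop_body_def step_old_def step_new_def insert_next_def Let_def split: if_splits)

text \<open>The termination measure is the size of this set, the candidates at or after some queued
  term; the queue itself can grow.\<close>

definition remaining :: "('n, 's) state \<Rightarrow> 'n monomial set" where
  "remaining s = {u \<in> candidates. \<exists>t\<in>todo s. t = u \<or> prec t u}"

text \<open>Everything in the new queue lies strictly after \<open>w\<close>, which was itself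
  queued. So no candidate is gained, and \<open>w\<close> is lost.\<close>

lemma card_remaining_body:
  assumes "loop_inv s" "todo s \<noteq> {}"
  shows "card (remaining (loop_body prec H g L s)) < card (remaining s)"
proof (rule psubset_card_mono)
  show "finite (remaining s)"
    by (simp add: remaining_def finite_candidates)
  have Q: "todo s \<subseteq> candidates"
    using assms(1) by (auto simp: loop_inv_def queue_inv_def)
  then have "finite (todo s)"
    using finite_candidates finite_subset by blast
  define w where "w = next_term prec (todo s)"
  have w: "w \<in> todo s" and least: "\<And>u. u \<in> todo s \<Longrightarrow> u \<noteq> w \<Longrightarrow> prec w u"
    unfolding w_def using next_term[OF \<open>finite (todo s)\<close> assms(2)] by blast+
  have later: "prec w t" if "t \<in> todo (loop_body prec H g L s)" for t
  proof -
    have "t \<in> todo s - {w} \<or> (\<exists>i. t = w + axis i 1)"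
      using that todo_loop_body[of s] unfolding w_def by blast
    then show ?thesis
      using least prec_add_axis by blast
  qed
  then have "w \<notin> remaining (loop_body prec H g L s)"
    using prec_irrefl prec_trans unfolding remaining_def by blast
  moreover have "w \<in> remaining s"
    using w Q unfolding remaining_def by blast
  moreover have "remaining (loop_body prec H g L s) \<subseteq> remaining s"
    using later w prec_trans unfolding remaining_def by blast
  ultimately show "remaining (loop_body prec H g L s) \<subset> remaining s"
    by blast
qed

section \<open>From the initial state to the returned set\<close>

lemma loop_inv_initial: "loop_inv initial_state"
  by (auto simp: loop_inv_def initial_state_def queue_inv_def block_inv_def binomials_def
      candidates_def intro!: exI[of _ "{}"])

lemma algorithm_correct: "ecrgb_algorithm prec H g L = Some (ECrGb g L)"
proof -
  let ?loop = "while_option (\<lambda>s. todo s \<noteq> {}) (loop_body prec H g L) initial_state"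
  obtain s where s: "?loop = Some s"
    using measure_while_option_Some[of loop_inv "\<lambda>s. todo s \<noteq> {}" "loop_body prec H g L"
        "\<lambda>s. card (remaining s)" initial_state]
      loop_inv_body card_remaining_body loop_inv_initial by blast
  have "todo s = {}"
    using while_option_stop[OF s] by simp
  moreover have "loop_inv s"
    using while_option_rule[OF loop_inv_body s loop_inv_initial] .
  ultimately obtain P where P: "queue_inv P {}" "result s = binomials P"
    by (auto simp: loop_inv_def)
  \<comment> \<open>With an empty queue, the ordering premise of
    \<open>queue_inv_smaller_met\<close> is vacuous, so every irredundant term has been met.\<close>
  have "P = irredundant_terms g L"
    using queue_inv_smaller_met[OF P(1)] P(1) by (auto simp: queue_inv_def)
  then show ?thesis
    by (simp add: ecrgb_algorithm_def s P(2) ECrGb_eq_binomials)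
qed

end

theorem theorem4p3:
  fixes g :: "'n::finite \<Rightarrow> nat"
    and L :: "('n \<Rightarrow> int) set"
    and H :: "real ^ 's::finite ^ 'n"
    and prec :: "'n monomial \<Rightarrow> 'n monomial \<Rightarrow> bool"
  assumes "\<And>i. 0 < g i"
    and "subgroup L (ambient_group g)"
    and "parity_check_matrix g L H"
    and "admissible_ordering prec"
    and "total_degree_compatible prec"
  shows "ecrgb_algorithm prec H g L = Some (ECrGb g L)"
proof -
  interpret ordered_lattice_code g L H prec
    by (intro ordered_lattice_code.intro lattice_code.intro ordered_lattice_code_axioms.intro assms)
  show ?thesis
    by (rule algorithm_correct)
qed

end
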